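(* Let $\gamma>0$ and suppose that $-\gamma I\preceq\nabla^2h(x)\preceq\gamma I$ for every $x\in\mathbb R^n$. Consider the Meta-ISAD algorithm described in the context, run with $\phi(x)=\frac{\gamma}{2}\|x\|^2-h(x)$ and with penalties $\beta_{t+1}=\mathrm{APO}_{\mathrm B}(\beta_t,\bar M^{t+1})$, where $\mathrm{APO}_{\mathrm B}$ is the bounded-Hessian penalty oracle described in the context. Then $\mathrm{APO}_{\mathrm B}$ fulfills the APO requirements: it returns positive scalars and, almost surely, there is an index $K_{stable}>0$ such that 1. $\beta_k=\beta_{K_{stable}}$ for all $k>K_{stable}$; 2. there exists $\rho>0$ such that for all $k>K_{stable}$, $$g^{k+1}(x_{k+1})-g^{k+1}(x_k)\le-\frac{\rho}{2}\|x_{k+1}-x_k\|^2$$ and $$\rho>\frac{8}{\beta_k\sigma}\Big(\big(L^e_{\nabla h+\nabla\phi}(\{x_t\}_{t\ge0})\big)^2+\big(L^e_{\nabla\phi}(\{x_t\}_{t\ge0})\big)^2\Big).$$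
   Context: **Problem.** $\min_{x\in\mathbb R^n}h(x)+P(\mathbb E[M]x)$, where $h:\mathbb R^n\to\mathbb R$ is twice continuously differentiable; $P:\mathbb R^n\to\mathbb R\cup\{\infty\}$ is proper, lower semicontinuous and prox-tractable: for all $u\in\mathbb R^n$, $\mu>0$, the set $\operatorname{argmin}_{v}\{P(v)+\frac1{2\mu}\|v-u\|^2\}$ is nonempty (and an element is efficiently computable). $M\in\mathbb R^{n\times n}$ is a random matrix with distribution $\pi$, entrywise expectation $\mathbb E[M]$ and finite entrywise variance; $\mathbb E[M]$ has full rank, so $\sigma:=\lambda_{\min}(\mathbb E[M]^T\mathbb E[M])>0$. The sampled matrices $M^1,M^2,\dots$ are i.i.d. with distribution $\pi$. Norms are $\ell_2$ (for matrices, the induced $\ell_2$ norm). **Sampling regime.** Fix an arbitrary $\epsilon_s>0$. If all entries of the sampled matrices are sub-Gaussian (a random variable $X$ is sub-Gaussian if $\mathbb E[\exp(X^2/K)]\le 2$ for some $K>0$), then $\theta_t=\lceil t^{1+\epsilon_s}\rceil$; otherwise $\theta_t=\lceil t^{2+\epsilon_s}\rceil$. **Meta-ISAD algorithm.** Input: $x_0,z_0\in\mathbb R^n$ ($y_0$ arbitrary), $\beta_0>0$, $\{\theta_t\}$, and a convex $\phi\in C^2(\mathbb R^n)$, with $D_\phi(x,x')=\phi(x)-\phi(x')-\langle\nabla\phi(x'),x-x'\rangle$. For $t=0,1,2,\dots$: sample $M^{\theta_t+1},\dots,M^{\theta_{t+1}}$ and set $\bar M^{t+1}=\frac{1}{\theta_{t+1}}\sum_{i=1}^{\theta_{t+1}}M^i$;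 then - $y_{t+1}\in\operatorname{argmin}_y\{P(y)+\langle z_t,y\rangle+\frac{\beta_t}{2}\|\bar M^{t+1}x_t-y\|^2\}$; - $x_{t+1}$ is a critical point (zero gradient) of $g^{t+1}(x):=h(x)-\langle z_t,\bar M^{t+1}x\rangle+\frac{\beta_t}{2}\|\bar M^{t+1}x-y_{t+1}\|^2+D_\phi(x,x_t)$ (for the present choice of $\phi$, the minimizer of $g^{t+1}$); - $z_{t+1}=z_t-\beta_t(\bar M^{t+1}x_{t+1}-y_{t+1})$; - $\beta_{t+1}$ is the output of a penalty oracle. The generated sequence $\{(x_t,y_t,z_t)\}_{t>0}$ is assumed to be bounded (standing assumption). **Oracle $\mathrm{APO}_{\mathrm B}$.** Parameters $\gamma>0$ (the Hessian bound) and $\epsilon>0$. Given $\beta>0$ and a matrix $A\in\mathbb R^{n\times n}$, set $\tilde\sigma=\lambda_{\min}(A^TA)$. If $\tilde\sigma=0$, or if $\frac{(1+0.5\epsilon)\cdot40\gamma^2}{\tilde\sigma\beta}<\tilde\sigma\beta+\gamma<\frac{(1+2\epsilon)\cdot40\gamma^2}{\tilde\sigma\beta}$, return $\beta$. Otherwise return $\frac{-\gamma+\sqrt{\gamma^2+(1+\epsilon)160\gamma^2}}{2\tilde\sigma}$. **Empirical Lipschitz constant.** For $F:\mathbb R^k\to\mathbb R^l$ and a sequence $\{x_t\}_{t\ge0}$, $L^e_F(\{x_t\}_{t\ge0})=\sup_{t\ge0,\,x_{t+1}\ne x_t}\frac{\|F(x_{t+1})-F(x_t)\|}{\|x_{t+1}-x_t\|}$,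 and it equals $0$ if $x_{t+1}=x_t$ for all $t$. *)

theory Defs
  imports "HOL-Analysis.Analysis" "HOL-Probability.Probability"
begin

definition gradient :: "('a::real_inner \<Rightarrow> real) \<Rightarrow> 'a \<Rightarrow> 'a" where
  "gradient f x = (THE g. GDERIV f x :> g)"

definition hessian :: "(real^'n \<Rightarrow> real) \<Rightarrow> real^'n \<Rightarrow> real^'n^'n" where
  "hessian f x = jacobian (gradient f) (at x)"

definition twice_continuously_differentiable :: "(real^'n \<Rightarrow> real) \<Rightarrow> bool" where
  "twice_continuously_differentiable f \<longleftrightarrow>
     (\<forall>x. f differentiable at x) \<and> (\<forall>x. gradient f differentiable at x) \<and>
     continuous_on UNIV (hessian f)"

text \<open>The Loewner order. It is used only between symmetric matrices (Hessians of twice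
  continuously differentiable functions and multiples of the identity), so the quadratic
  form alone decides whether \<open>B - A\<close> is positive semidefinite.\<close>

definition loewner_le :: "real^'n^'n \<Rightarrow> real^'n^'n \<Rightarrow> bool" where
  "loewner_le A B \<longleftrightarrow> (\<forall>v. 0 \<le> v \<bullet> ((B - A) *v v))"

text \<open>Smallest real eigenvalue; meaningful for symmetric matrices, which always have one.\<close>

definition lambda_min :: "real^'n^'n \<Rightarrow> real" where
  "lambda_min A = Min {c. \<exists>v. v \<noteq> 0 \<and> A *v v = c *\<^sub>R v}"

definition proper_fun :: "('a \<Rightarrow> ereal) \<Rightarrow> bool" where
  "proper_fun P \<longleftrightarrow> (\<forall>v. P v \<noteq> -\<infinity>) \<and> (\<exists>v. P v \<noteq> \<infinity>)"

definition lower_semicontinuous :: "('a::topological_space \<Rightarrow> ereal) \<Rightarrow> bool" where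
  "lower_semicontinuous P \<longleftrightarrow> (\<forall>v. P v \<le> Liminf (at v) P)"

definition argmin :: "('a \<Rightarrow> 'b::linorder) \<Rightarrow> 'a set" where
  "argmin F = {v. is_arg_min F (\<lambda>_. True) v}"

definition prox_tractable :: "('a::real_normed_vector \<Rightarrow> ereal) \<Rightarrow> bool" where
  "prox_tractable P \<longleftrightarrow>
     (\<forall>u. \<forall>\<mu>>0. argmin (\<lambda>v. P v + ereal (1 / (2 * \<mu>) * (norm (v - u))\<^sup>2)) \<noteq> {})"

definition expected_matrix :: "(real^'n^'n) measure \<Rightarrow> real^'n^'n" where
  "expected_matrix \<pi> = (\<chi> i j. \<integral>A. A $ i $ j \<partial>\<pi>)"

definition finite_entrywise_variance :: "(real^'n^'n) measure \<Rightarrow> bool" where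
  "finite_entrywise_variance \<pi> \<longleftrightarrow>
     (\<forall>i j. integrable \<pi> (\<lambda>A. A $ i $ j) \<and>
            integrable \<pi> (\<lambda>A. (A $ i $ j - expected_matrix \<pi> $ i $ j)\<^sup>2))"

text \<open>The Lebesgue integral of a nonnegative function is used because the Bochner integral
  of a non-integrable function is \<open>0\<close>.\<close>

definition sub_gaussian :: "'w measure \<Rightarrow> ('w \<Rightarrow> real) \<Rightarrow> bool" where
  "sub_gaussian W X \<longleftrightarrow> (\<exists>K>0. (\<integral>\<^sup>+\<omega>. ennreal (exp ((X \<omega>)\<^sup>2 / K)) \<partial>W) \<le> 2)"

definition sample_size :: "(real^'n^'n) measure \<Rightarrow> real \<Rightarrow> nat \<Rightarrow> nat" where
  "sample_size \<pi> \<epsilon>s t =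
     (if \<forall>i j. sub_gaussian \<pi> (\<lambda>A. A $ i $ j)
      then nat \<lceil>real t powr (1 + \<epsilon>s)\<rceil>
      else nat \<lceil>real t powr (2 + \<epsilon>s)\<rceil>)"

definition sample_mean :: "(nat \<Rightarrow> nat) \<Rightarrow> (nat \<Rightarrow> 'v::real_vector) \<Rightarrow> nat \<Rightarrow> 'v" where
  "sample_mean \<theta> M t = (1 / real (\<theta> t)) *\<^sub>R (\<Sum>i=1..\<theta> t. M i)"

text \<open>The samples are \<open>M 1, M 2, \<dots>\<close>; the value of \<open>M 0\<close> is irrelevant.\<close>

definition iid_samples ::
  "'w measure \<Rightarrow> (real^'n^'n) measure \<Rightarrow> (nat \<Rightarrow> 'w \<Rightarrow> real^'n^'n) \<Rightarrow> bool" where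
  "iid_samples W \<pi> M \<longleftrightarrow>
     prob_space.indep_vars W (\<lambda>_. borel) M {1..} \<and>
     (\<forall>i\<ge>1. M i \<in> borel_measurable W \<and> distr W borel (M i) = \<pi>)"

definition bregman :: "('a::real_inner \<Rightarrow> real) \<Rightarrow> 'a \<Rightarrow> 'a \<Rightarrow> real" where
  "bregman \<phi> x x' = \<phi> x - \<phi> x' - gradient \<phi> x' \<bullet> (x - x')"

definition g_objective ::
  "(real^'n \<Rightarrow> real) \<Rightarrow> (real^'n \<Rightarrow> real) \<Rightarrow> real \<Rightarrow> real^'n^'n \<Rightarrow>
   real^'n \<Rightarrow> real^'n \<Rightarrow> real^'n \<Rightarrow> real^'n \<Rightarrow> real" where
  "g_objective h \<phi> b A z y' x\<^sub>t x =
     h x - z \<bullet> (A *v x) + b / 2 * (norm (A *v x - y'))\<^sup>2 + bregman \<phi> x x\<^sub>t"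

text \<open>The objective whose critical point is the iterate \<open>x k\<close>; only \<open>k > 0\<close> is meaningful.
  \<open>Mbar k\<close> is the sample mean used to compute the iterate with index \<open>k\<close>.\<close>

definition meta_ISAD_g ::
  "(real^'n \<Rightarrow> real) \<Rightarrow> (real^'n \<Rightarrow> real) \<Rightarrow> (nat \<Rightarrow> real^'n^'n) \<Rightarrow>
   (nat \<Rightarrow> real^'n) \<Rightarrow> (nat \<Rightarrow> real^'n) \<Rightarrow> (nat \<Rightarrow> real^'n) \<Rightarrow> (nat \<Rightarrow> real) \<Rightarrow>
   nat \<Rightarrow> real^'n \<Rightarrow> real" where
  "meta_ISAD_g h \<phi> Mbar x y z \<beta> k =
     g_objective h \<phi> (\<beta> (k - 1)) (Mbar k) (z (k - 1)) (y k) (x (k - 1))"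

text \<open>One trajectory of the algorithm; \<open>oracle\<close> maps the current penalty and the current
  sample mean to the next penalty.\<close>

definition meta_ISAD_run ::
  "(real^'n \<Rightarrow> real) \<Rightarrow> (real^'n \<Rightarrow> ereal) \<Rightarrow> (real^'n \<Rightarrow> real) \<Rightarrow>
   (real \<Rightarrow> real^'n^'n \<Rightarrow> real) \<Rightarrow> (nat \<Rightarrow> real^'n^'n) \<Rightarrow>
   real^'n \<Rightarrow> real^'n \<Rightarrow> real \<Rightarrow>
   (nat \<Rightarrow> real^'n) \<Rightarrow> (nat \<Rightarrow> real^'n) \<Rightarrow> (nat \<Rightarrow> real^'n) \<Rightarrow> (nat \<Rightarrow> real) \<Rightarrow> bool" where
  "meta_ISAD_run h P \<phi> oracle Mbar x0 z0 \<beta>0 x y z \<beta> \<longleftrightarrow>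
     x 0 = x0 \<and> z 0 = z0 \<and> \<beta> 0 = \<beta>0 \<and>
     (\<forall>t.
        y (Suc t) \<in> argmin (\<lambda>v. P v +
          ereal (z t \<bullet> v + \<beta> t / 2 * (norm (Mbar (Suc t) *v x t - v))\<^sup>2)) \<and>
        GDERIV (meta_ISAD_g h \<phi> Mbar x y z \<beta> (Suc t)) (x (Suc t)) :> 0 \<and>
        z (Suc t) = z t - \<beta> t *\<^sub>R (Mbar (Suc t) *v x (Suc t) - y (Suc t)) \<and>
        \<beta> (Suc t) = oracle (\<beta> t) (Mbar (Suc t)))"

definition APO_B :: "real \<Rightarrow> real \<Rightarrow> real \<Rightarrow> real^'n^'n \<Rightarrow> real" where
  "APO_B \<gamma> \<epsilon> b A =
     (let s = lambda_min (transpose A ** A) in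
      if s = 0 \<or>
         (1 + 0.5 * \<epsilon>) * (40 * \<gamma>\<^sup>2) / (s * b) < s * b + \<gamma> \<and>
         s * b + \<gamma> < (1 + 2 * \<epsilon>) * (40 * \<gamma>\<^sup>2) / (s * b)
      then b
      else (- \<gamma> + sqrt (\<gamma>\<^sup>2 + (1 + \<epsilon>) * 160 * \<gamma>\<^sup>2)) / (2 * s))"

text \<open>Extended-real valued, as the supremum may be infinite.\<close>

definition empirical_lipschitz ::
  "('a::real_normed_vector \<Rightarrow> 'b::real_normed_vector) \<Rightarrow> (nat \<Rightarrow> 'a) \<Rightarrow> ereal" where
  "empirical_lipschitz F x =
     (if \<forall>t. x (Suc t) = x t then 0
      else SUP t \<in> {t. x (Suc t) \<noteq> x t}.
             ereal (norm (F (x (Suc t)) - F (x t)) / norm (x (Suc t) - x t)))"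

end

theory Submission
  imports Defs
begin

text \<open>
  The choice \<open>\<phi> = \<gamma>/2 |.|\<^sup>2 - h\<close> cancels \<open>h\<close> in the subproblem, so that \<open>g\<close> is a quadratic
  function with Hessian \<open>\<gamma> I + \<beta> A\<^sup>T A\<close>, where \<open>A\<close> is the current sample mean. A step from \<open>x k\<close> to
  the critical point therefore decreases \<open>g\<close> by at least \<open>(\<gamma> + \<beta> s) / 2\<close> times the squared step
  length, with \<open>s = lambda_min (A\<^sup>T A)\<close> (\<open>g_objective_descent\<close>). The same choice makes
  \<open>\<nabla>h + \<nabla>\<phi>\<close> equal to \<open>\<gamma>\<close> times the identity, and it makes \<open>\<phi>\<close> convex with curvature at most
  \<open>2 \<gamma>\<close>, so the two empirical Lipschitz constants are at most \<open>\<gamma>\<close> and \<open>2 \<gamma>\<close>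
  (\<open>empirical_lipschitz_\<phi>\<close>). What has to be shown is thus that eventually
  \<open>\<gamma> + \<beta> s \<ge> \<rho> > 8 \<cdot> 5 \<gamma>\<^sup>2 / (\<beta> \<sigma>)\<close> for one fixed \<open>\<rho>\<close>, which is where the number 40 in the oracle
  comes from.

  The sample sizes grow at least like \<open>t\<close> to a power larger than 1, so the variances of the
  sample means are summable and the means converge almost surely
  (\<open>AE_sample_mean_matrix_tendsto\<close>). Since \<open>lambda_min (A\<^sup>T A)\<close> is continuous in \<open>A\<close>, almost surely
  \<open>s\<close> converges to \<open>\<sigma> > 0\<close>, and only such trajectories are considered from there on.

  In terms of \<open>u = s \<beta>\<close> the oracle tests whether \<open>u (u + \<gamma>)\<close> lies in the window from
  \<open>(1 + \<epsilon>/2) 40 \<gamma>\<^sup>2\<close> to \<open>(1 + 2\<epsilon>) 40 \<gamma>\<^sup>2\<close>, and otherwise resets \<open>\<beta>\<close> so that \<open>u (u + \<gamma>)\<close> equals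
  \<open>(1 + \<epsilon>) 40 \<gamma>\<^sup>2\<close>, an interior point of the window. Once the values of \<open>s\<close> are relatively close to
  each other, their further changes cannot move \<open>u\<close> from that point out of the window, so that at
  most one more reset takes place (\<open>penalties_stabilise\<close>). The lower end of the window survives
  the limit \<open>s \<rightarrow> \<sigma>\<close> as a weak inequality; the factor \<open>1 + \<epsilon>/2\<close> turns it into the strict
  inequality \<open>40 \<gamma>\<^sup>2 / (\<beta> \<sigma>) < \<gamma> + \<beta> \<sigma>\<close>, and any \<open>\<rho>\<close> strictly between the two sides will do
  (\<open>stabilised_penalty_margin\<close>).
\<close>

section \<open>The smallest eigenvalue of a Gram matrix\<close>

text \<open>
  Eigenvectors to distinct eigenvalues are orthogonal, hence linearly independent. Finiteness is
  what gives meaning to the minimum in \<^const>\<open>lambda_min\<close>.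
\<close>

lemma finite_eigenvalues_symmetric:
  fixes B :: "real^'n^'n"
  assumes "transpose B = B"
  shows "finite {c. \<exists>v. v \<noteq> 0 \<and> B *v v = c *\<^sub>R v}" (is "finite ?E")
proof -
  define w where "w c = (SOME v. v \<noteq> 0 \<and> B *v v = c *\<^sub>R v)" for c
  have w: "w c \<noteq> 0" "B *v w c = c *\<^sub>R w c" if "c \<in> ?E" for c
    using that someI_ex[of "\<lambda>v. v \<noteq> 0 \<and> B *v v = c *\<^sub>R v"] unfolding w_def by auto
  have orth: "w c \<bullet> w d = 0" if "c \<in> ?E" "d \<in> ?E" "c \<noteq> d" for c d
  proof -
    have "(B *v w c) \<bullet> w d = w c \<bullet> (B *v w d)"
      by (metis assms dot_lmul_matrix vector_transpose_matrix)
    then show ?thesis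
      using that w by auto
  qed
  have inj: "inj_on w ?E"
  proof (rule inj_onI, rule ccontr)
    fix c d assume "c \<in> ?E" "d \<in> ?E" "w c = w d" "c \<noteq> d"
    then show False using orth[of c d] w(1)[of c] by simp
  qed
  have "pairwise orthogonal (w ` ?E)"
    unfolding pairwise_def orthogonal_def using orth by blast
  moreover have "0 \<notin> w ` ?E"
    using w(1) by fastforce
  ultimately have "finite (w ` ?E)"
    using pairwise_orthogonal_independent independent_imp_finite by blast
  with inj show ?thesis
    by (rule finite_imageD[rotated])
qed

lemma gram_quadratic_form:
  fixes A :: "real^'n^'m"
  shows "v \<bullet> ((transpose A ** A) *v w) = (A *v v) \<bullet> (A *v w)"
  by (simp add: dot_lmul_matrix flip: matrix_vector_mul_assoc)
     (metis dot_lmul_matrix inner_commute vector_transpose_matrix)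

text \<open>
  The variational characterisation: a minimiser \<open>u\<close> of \<open>|A v|\<^sup>2\<close> on the unit sphere exists by
  compactness. With \<open>m\<close> the minimum, the form \<open>|A v|\<^sup>2 - m |v|\<^sup>2\<close> is nonnegative and vanishes at
  \<open>u\<close>, so its gradient there vanishes too, which says that \<open>m\<close> is an eigenvalue; no eigenvalue can
  be smaller.
\<close>

lemma lambda_min_gram:
  fixes A :: "real^'n^'n"
  shows lambda_min_gram_attained:
      "\<exists>v. norm v = 1 \<and> (norm (A *v v))\<^sup>2 = lambda_min (transpose A ** A)"
    and lambda_min_gram_le:
      "lambda_min (transpose A ** A) * (norm v)\<^sup>2 \<le> (norm (A *v v))\<^sup>2"
proof -
  let ?G = "transpose A ** A"
  have cont: "continuous_on (sphere (0::real^'n) 1) (\<lambda>v. (norm (A *v v))\<^sup>2)"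
    by (intro continuous_intros)
  have "sphere (0::real^'n) 1 \<noteq> {}" by simp
  then obtain u where u: "norm u = 1"
    and umin: "\<And>v. norm v = 1 \<Longrightarrow> (norm (A *v u))\<^sup>2 \<le> (norm (A *v v))\<^sup>2"
    using continuous_attains_inf[OF compact_sphere _ cont] by auto
  define m where "m = (norm (A *v u))\<^sup>2"
  have m_le: "m * (norm v)\<^sup>2 \<le> (norm (A *v v))\<^sup>2" for v
  proof (cases "v = 0")
    case False
    have "m \<le> (norm (A *v (v /\<^sub>R norm v)))\<^sup>2"
      unfolding m_def using False by (intro umin) simp
    also have "\<dots> = (norm (A *v v))\<^sup>2 / (norm v)\<^sup>2"
      by (simp add: matrix_vector_mult_scaleR power_mult_distrib power_divide field_simps)
    finally show ?thesis using False by (simp add: field_simps)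
  qed simp
  have "?G *v u - m *\<^sub>R u = 0"
  proof -
    define r where "r = ?G *v u - m *\<^sub>R u"
    define q where "q = (norm (A *v r))\<^sup>2 - m * (norm r)\<^sup>2"
    have "0 \<le> 2 * t * (r \<bullet> r) + t\<^sup>2 * q" for t
    proof -
      have "(norm (A *v (u + t *\<^sub>R r)))\<^sup>2 - m * (norm (u + t *\<^sub>R r))\<^sup>2 =
        ((norm (A *v u))\<^sup>2 - m * (norm u)\<^sup>2) +
        2 * t * ((A *v r) \<bullet> (A *v u) - m * (r \<bullet> u)) + t\<^sup>2 * q"
        unfolding q_def power2_norm_eq_inner
        by (simp add: matrix_vector_right_distrib matrix_vector_mult_scaleR inner_add_left inner_add_right
            inner_commute algebra_simps power2_eq_square)
      also have "(A *v r) \<bullet> (A *v u) - m * (r \<bullet> u) = r \<bullet> r"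
        by (simp add: gram_quadratic_form[symmetric] r_def inner_diff_right)
      finally show ?thesis
        using m_le[of "u + t *\<^sub>R r"] u by (simp add: m_def)
    qed note nonneg = this
    \<comment> \<open>For negative \<open>t\<close> of modulus at most \<open>(r \<bullet> r) / |q|\<close> the linear term dominates, so it has to vanish; the \<open>+ 1\<close> in the choice
        of \<open>t\<close> covers \<open>q = 0\<close>.\<close>
    have "r \<bullet> r = 0"
    proof (rule ccontr)
      assume "r \<bullet> r \<noteq> 0"
      then have p: "r \<bullet> r > 0" by simp
      define t where "t = - (r \<bullet> r) / (\<bar>q\<bar> + 1)"
      have t: "t < 0" unfolding t_def using p by (simp add: divide_neg_pos)
      have "- (t * q) \<le> \<bar>t\<bar> * \<bar>q\<bar>" by (metis abs_ge_minus_self abs_mult)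
      also have "\<dots> = (r \<bullet> r) * (\<bar>q\<bar> / (\<bar>q\<bar> + 1))" using p by (simp add: t_def abs_divide)
      also have "\<dots> \<le> r \<bullet> r" using p by (intro mult_left_le) (auto simp: field_simps)
      finally have "2 * (r \<bullet> r) + t * q > 0" using p by linarith
      then have "t * (2 * (r \<bullet> r) + t * q) < 0" using t by (simp add: mult_neg_pos)
      then show False
        using nonneg[of t] by (simp add: algebra_simps power2_eq_square)
    qed
    then show ?thesis by (simp add: r_def)
  qed
  then have eig: "m \<in> {c. \<exists>v. v \<noteq> 0 \<and> ?G *v v = c *\<^sub>R v}"
    using u by (auto intro!: exI[of _ u])
  have "m \<le> c" if "v \<noteq> 0" "?G *v v = c *\<^sub>R v" for c v
  proof -
    have "(norm (A *v v))\<^sup>2 = c * (norm v)\<^sup>2"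
      using gram_quadratic_form[of v A v] that by (simp add: power2_norm_eq_inner)
    then show ?thesis using m_le[of v] that by simp
  qed
  then have min: "lambda_min ?G = m"
    unfolding lambda_min_def
    by (intro Min_eqI finite_eigenvalues_symmetric eig)
       (auto simp: matrix_transpose_mul)
  show "\<exists>v. norm v = 1 \<and> (norm (A *v v))\<^sup>2 = lambda_min ?G"
    unfolding min m_def using u by blast
  show "lambda_min ?G * (norm v)\<^sup>2 \<le> (norm (A *v v))\<^sup>2" for v
    using m_le min by simp
qed

lemma lambda_min_gram_nonneg:
  fixes A :: "real^'n^'n"
  shows "0 \<le> lambda_min (transpose A ** A)"
  by (metis lambda_min_gram_attained zero_le_power2)

lemma lambda_min_gram_pos:
  fixes A :: "real^'n^'n"
  assumes "rank A = CARD('n)"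
  shows "0 < lambda_min (transpose A ** A)"
proof -
  obtain v where v: "norm v = 1" "(norm (A *v v))\<^sup>2 = lambda_min (transpose A ** A)"
    using lambda_min_gram_attained by blast
  have "inj ((*v) A)" using assms full_rank_injective by blast
  then have "A *v v \<noteq> 0"
    using v(1) by (metis injD matrix_vector_mult_0_right norm_zero zero_neq_one)
  then show ?thesis using v(2) by (metis norm_eq_zero zero_less_power2)
qed

text \<open>
  The square root of the eigenvalue is the smallest singular value, a minimum over the sphere of
  functions of the matrix that are 1-Lipschitz for the operator norm; the entrywise sum bounds that norm.
\<close>

lemma sqrt_lambda_min_gram_perturb:
  fixes A B :: "real^'n^'n"
  shows "sqrt (lambda_min (transpose A ** A)) \<le>
    sqrt (lambda_min (transpose B ** B)) + (\<Sum>i\<in>UNIV. \<Sum>j\<in>UNIV. \<bar>A $ i $ j - B $ i $ j\<bar>)"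
proof -
  obtain v where v: "norm v = 1" "(norm (B *v v))\<^sup>2 = lambda_min (transpose B ** B)"
    using lambda_min_gram_attained by blast
  have "sqrt (lambda_min (transpose A ** A)) \<le> norm (A *v v)"
    using lambda_min_gram_le[of A v] v(1) by (simp add: real_le_lsqrt)
  also have "A *v v = B *v v + (A - B) *v v"
    by (simp add: matrix_vector_mult_diff_rdistrib)
  also have "norm \<dots> \<le> norm (B *v v) + norm ((A - B) *v v)"
    by (rule norm_triangle_ineq)
  also have "norm ((A - B) *v v) \<le> onorm ((*v) (A - B))"
    using onorm[OF matrix_vector_mul_bounded_linear[of "A - B"], of v] v(1) by simp
  also have "\<dots> \<le> (\<Sum>i\<in>UNIV. \<Sum>j\<in>UNIV. \<bar>A $ i $ j - B $ i $ j\<bar>)"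
    using onorm_le_matrix_component_sum[of "A - B"] by simp
  also have "norm (B *v v) = sqrt (lambda_min (transpose B ** B))"
    using v(2) by (simp flip: v(2))
  finally show ?thesis by simp
qed

lemma tendsto_lambda_min_gram:
  fixes A :: "'a \<Rightarrow> real^'n^'n"
  assumes "\<And>i j. ((\<lambda>t. A t $ i $ j) \<longlongrightarrow> B $ i $ j) F"
  shows "((\<lambda>t. lambda_min (transpose (A t) ** A t)) \<longlongrightarrow> lambda_min (transpose B ** B)) F"
proof -
  define d where "d t = (\<Sum>i\<in>UNIV. \<Sum>j\<in>UNIV. \<bar>A t $ i $ j - B $ i $ j\<bar>)" for t
  have "((\<lambda>t. \<bar>A t $ i $ j - B $ i $ j\<bar>) \<longlongrightarrow> 0) F" for i j
    using assms[of i j] by (intro tendsto_rabs_zero) (simp add: LIM_zero)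
  then have d: "(d \<longlongrightarrow> 0) F"
    unfolding d_def[abs_def] by (intro tendsto_null_sum)
  have "((\<lambda>t. sqrt (lambda_min (transpose (A t) ** A t)) - sqrt (lambda_min (transpose B ** B))) \<longlongrightarrow> 0) F"
  proof (rule Lim_null_comparison[OF _ d])
    show "\<forall>\<^sub>F t in F. norm (sqrt (lambda_min (transpose (A t) ** A t)) -
        sqrt (lambda_min (transpose B ** B))) \<le> d t"
    proof (rule always_eventually, rule allI)
      fix t
      show "norm (sqrt (lambda_min (transpose (A t) ** A t)) - sqrt (lambda_min (transpose B ** B))) \<le> d t"
        using sqrt_lambda_min_gram_perturb[of "A t" B] sqrt_lambda_min_gram_perturb[of B "A t"]
        by (simp add: d_def abs_minus_commute)
    qed
  qed
  then have "((\<lambda>t. sqrt (lambda_min (transpose (A t) ** A t))) \<longlongrightarrow> sqrt (lambda_min (transpose B ** B))) F"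
    by (simp add: LIM_zero_iff)
  from tendsto_power[OF this, of 2] show ?thesis
    by (simp add: lambda_min_gram_nonneg)
qed

section \<open>Almost sure convergence of the sample means\<close>

lemma (in prob_space) second_moment_sum_indep:
  fixes X :: "'i \<Rightarrow> 'a \<Rightarrow> real"
  assumes fin: "finite I" and ind: "indep_vars (\<lambda>_. borel) X I"
    and int: "\<And>i. i \<in> I \<Longrightarrow> integrable M (X i)"
    and sq: "\<And>i. i \<in> I \<Longrightarrow> integrable M (\<lambda>\<omega>. (X i \<omega>)\<^sup>2)"
    and mean: "\<And>i. i \<in> I \<Longrightarrow> expectation (X i) = 0"
  shows "integrable M (\<lambda>\<omega>. (\<Sum>i\<in>I. X i \<omega>)\<^sup>2)"
    and "expectation (\<lambda>\<omega>. (\<Sum>i\<in>I. X i \<omega>)\<^sup>2) = (\<Sum>i\<in>I. expectation (\<lambda>\<omega>. (X i \<omega>)\<^sup>2))"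
proof -
  have cross: "integrable M (\<lambda>\<omega>. X i \<omega> * X j \<omega>)" "expectation (\<lambda>\<omega>. X i \<omega> * X j \<omega>) = 0"
    if "i \<in> I" "j \<in> I" "i \<noteq> j" for i j
  proof -
    have ij: "indep_vars (\<lambda>_. borel) X {i, j}"
      using that by (intro indep_vars_subset[OF ind]) auto
    show "integrable M (\<lambda>\<omega>. X i \<omega> * X j \<omega>)"
      using indep_vars_integrable[OF _ ij] that int by auto
    show "expectation (\<lambda>\<omega>. X i \<omega> * X j \<omega>) = 0"
      using indep_vars_lebesgue_integral[OF _ ij] that int mean by auto
  qed
  have int2: "integrable M (\<lambda>\<omega>. X i \<omega> * X j \<omega>)" if "i \<in> I" "j \<in> I" for i j
    using cross(1)[OF that] sq[OF that(1)] by (cases "i = j") (auto simp: power2_eq_square)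
  have expand: "(\<Sum>i\<in>I. X i \<omega>)\<^sup>2 = (\<Sum>i\<in>I. \<Sum>j\<in>I. X i \<omega> * X j \<omega>)" for \<omega>
    by (simp add: power2_eq_square sum_product)
  show "integrable M (\<lambda>\<omega>. (\<Sum>i\<in>I. X i \<omega>)\<^sup>2)"
    unfolding expand using int2 by (intro Bochner_Integration.integrable_sum) auto
  have "expectation (\<lambda>\<omega>. (\<Sum>i\<in>I. X i \<omega>)\<^sup>2) = (\<Sum>i\<in>I. \<Sum>j\<in>I. expectation (\<lambda>\<omega>. X i \<omega> * X j \<omega>))"
    unfolding expand using int2
    by (simp add: Bochner_Integration.integral_sum Bochner_Integration.integrable_sum)
  also have "\<dots> = (\<Sum>i\<in>I. \<Sum>j\<in>I. if j = i then expectation (\<lambda>\<omega>. (X i \<omega>)\<^sup>2) else 0)"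
    by (intro sum.cong refl) (auto simp: cross power2_eq_square)
  also have "\<dots> = (\<Sum>i\<in>I. expectation (\<lambda>\<omega>. (X i \<omega>)\<^sup>2))"
    using fin by (simp add: sum.delta)
  finally show "expectation (\<lambda>\<omega>. (\<Sum>i\<in>I. X i \<omega>)\<^sup>2) = (\<Sum>i\<in>I. expectation (\<lambda>\<omega>. (X i \<omega>)\<^sup>2))" .
qed

text \<open>
  By monotone convergence the series of the \<open>(Y t)\<^sup>2\<close> has a finite integral, so it converges almost
  everywhere and its terms tend to 0. This plays the role of Chebyshev's inequality and the Borel--Cantelli
  lemma.
\<close>

lemma AE_tendsto_zero_of_summable_second_moments:
  fixes Y :: "nat \<Rightarrow> 'w \<Rightarrow> real"
  assumes int: "\<And>t. integrable W (\<lambda>\<omega>. (Y t \<omega>)\<^sup>2)"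
    and summable: "summable (\<lambda>t. \<integral>\<omega>. (Y t \<omega>)\<^sup>2 \<partial>W)"
  shows "AE \<omega> in W. (\<lambda>t. Y t \<omega>) \<longlonglongrightarrow> 0"
proof -
  have [measurable]: "(\<lambda>\<omega>. (Y t \<omega>)\<^sup>2) \<in> borel_measurable W" for t
    using int by auto
  have "(\<integral>\<^sup>+\<omega>. (\<Sum>t. ennreal ((Y t \<omega>)\<^sup>2)) \<partial>W) = (\<Sum>t. \<integral>\<^sup>+\<omega>. ennreal ((Y t \<omega>)\<^sup>2) \<partial>W)"
    by (rule nn_integral_suminf) simp
  also have "\<dots> = (\<Sum>t. ennreal (\<integral>\<omega>. (Y t \<omega>)\<^sup>2 \<partial>W))"
    using int by (simp add: nn_integral_eq_integral)
  also have "\<dots> = ennreal (\<Sum>t. \<integral>\<omega>. (Y t \<omega>)\<^sup>2 \<partial>W)"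
    using summable by (intro suminf_ennreal2) auto
  also have "\<dots> \<noteq> \<infinity>" by simp
  finally have "AE \<omega> in W. (\<Sum>t. ennreal ((Y t \<omega>)\<^sup>2)) \<noteq> \<infinity>"
    by (intro nn_integral_PInf_AE) simp_all
  then show ?thesis
  proof (rule AE_mp, intro AE_I2 impI)
    fix \<omega> assume "(\<Sum>t. ennreal ((Y t \<omega>)\<^sup>2)) \<noteq> \<infinity>"
    then have "summable (\<lambda>t. (Y t \<omega>)\<^sup>2)"
      by (intro summable_suminf_not_top) (auto simp: top_ennreal_def)
    then have "(\<lambda>t. (Y t \<omega>)\<^sup>2) \<longlonglongrightarrow> 0" by (rule summable_LIMSEQ_zero)
    then have "(\<lambda>t. sqrt ((Y t \<omega>)\<^sup>2)) \<longlonglongrightarrow> sqrt 0" by (rule tendsto_real_sqrt)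
    then show "(\<lambda>t. Y t \<omega>) \<longlonglongrightarrow> 0" by (simp add: tendsto_rabs_zero_iff)
  qed
qed

text \<open>
  A strong law along fast growing sample sizes: the variance of the mean of \<open>\<theta> t\<close> samples is
  \<open>v / \<theta> t \<le> v / t\<^sup>p\<close>, which is summable. The means at different \<open>t\<close> share samples and are
  dependent, which is harmless because only their individual variances enter.
\<close>

lemma AE_sample_mean_tendsto:
  fixes X :: "nat \<Rightarrow> 'w \<Rightarrow> real"
  assumes W: "prob_space W" and ind: "prob_space.indep_vars W (\<lambda>_. borel) X {1..}"
    and int: "\<And>i. i \<ge> 1 \<Longrightarrow> integrable W (X i)"
    and sq: "\<And>i. i \<ge> 1 \<Longrightarrow> integrable W (\<lambda>\<omega>. (X i \<omega> - \<mu>)\<^sup>2)"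
    and mean: "\<And>i. i \<ge> 1 \<Longrightarrow> (\<integral>\<omega>. X i \<omega> \<partial>W) = \<mu>"
    and var: "\<And>i. i \<ge> 1 \<Longrightarrow> (\<integral>\<omega>. (X i \<omega> - \<mu>)\<^sup>2 \<partial>W) = v"
    and p: "p > 1" and size: "\<And>t. t \<ge> 1 \<Longrightarrow> real t powr p \<le> real (\<theta> t)"
  shows "AE \<omega> in W. (\<lambda>t. sample_mean \<theta> (\<lambda>i. X i \<omega>) t) \<longlonglongrightarrow> \<mu>"
proof -
  interpret prob_space W by (rule W)
  define Z where "Z i \<omega> = X i \<omega> - \<mu>" for i \<omega>
  define Y where "Y t \<omega> = (1 / real (\<theta> t)) * (\<Sum>i=1..\<theta> t. Z i \<omega>)" for t \<omega>
  have indZ: "indep_vars (\<lambda>_. borel) Z {1..n}" for n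
    unfolding Z_def
    by (rule indep_vars_compose2[where Y="\<lambda>_ a. a - \<mu>", OF indep_vars_subset[OF ind]]) auto
  have Z: "integrable W (Z i)" "integrable W (\<lambda>\<omega>. (Z i \<omega>)\<^sup>2)" "expectation (Z i) = 0"
    "expectation (\<lambda>\<omega>. (Z i \<omega>)\<^sup>2) = v" if "i \<ge> 1" for i
    using int[OF that] sq[OF that] mean[OF that] var[OF that] by (auto simp: Z_def[abs_def] prob_space)
  have intY: "integrable W (\<lambda>\<omega>. (Y t \<omega>)\<^sup>2)" for t
    unfolding Y_def power_mult_distrib
    by (intro integrable_mult_right second_moment_sum_indep(1) indZ) (auto simp: Z)
  have EY: "expectation (\<lambda>\<omega>. (Y t \<omega>)\<^sup>2) = v / real (\<theta> t)" for t
  proof -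
    have "expectation (\<lambda>\<omega>. (\<Sum>i=1..\<theta> t. Z i \<omega>)\<^sup>2) = (\<Sum>i=1..\<theta> t. v)"
      by (subst second_moment_sum_indep(2)[OF _ indZ]) (auto simp: Z)
    then show ?thesis
      unfolding Y_def power_mult_distrib by (simp add: power2_eq_square)
  qed
  have "0 \<le> expectation (\<lambda>\<omega>. (X 1 \<omega> - \<mu>)\<^sup>2)" by simp
  then have v: "v \<ge> 0" by (simp only: var[OF order_refl])
  have "summable (\<lambda>t. v * (real t powr (- p)))"
    using p by (intro summable_mult) (simp add: summable_real_powr_iff)
  then have "summable (\<lambda>t. expectation (\<lambda>\<omega>. (Y t \<omega>)\<^sup>2))"
  proof (rule summable_comparison_test'[where N=1])
    fix t :: nat assume t: "t \<ge> 1"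
    have "v / real (\<theta> t) \<le> v / (real t powr p)"
      using size[OF t] v t less_le_trans[of 0 "real t powr p" "real (\<theta> t)"]
      by (intro divide_left_mono mult_pos_pos) simp_all
    then show "norm (expectation (\<lambda>\<omega>. (Y t \<omega>)\<^sup>2)) \<le> v * (real t powr (- p))"
      using v by (simp add: EY powr_minus divide_inverse)
  qed
  then have "AE \<omega> in W. (\<lambda>t. Y t \<omega>) \<longlonglongrightarrow> 0"
    by (rule AE_tendsto_zero_of_summable_second_moments[OF intY])
  then show ?thesis
  proof (rule AE_mp, intro AE_I2 impI)
    fix \<omega> assume "(\<lambda>t. Y t \<omega>) \<longlonglongrightarrow> 0"
    moreover have "\<forall>\<^sub>F t in sequentially. Y t \<omega> = sample_mean \<theta> (\<lambda>i. X i \<omega>) t - \<mu>"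
      using eventually_ge_at_top[of 1]
    proof eventually_elim
      case (elim t)
      then have "0 < real t powr p" by simp
      then have "0 < real (\<theta> t)" using size[of t] elim by linarith
      then show ?case
        by (simp add: Y_def Z_def sample_mean_def sum_subtractf field_simps)
    qed
    ultimately have "(\<lambda>t. sample_mean \<theta> (\<lambda>i. X i \<omega>) t - \<mu>) \<longlonglongrightarrow> 0"
      using tendsto_cong by force
    then show "(\<lambda>t. sample_mean \<theta> (\<lambda>i. X i \<omega>) t) \<longlonglongrightarrow> \<mu>"
      by (simp add: LIM_zero_iff)
  qed
qed

text \<open>
  In both sampling regimes the sample size is at least \<open>t powr (1 + \<epsilon>s)\<close>, and at this rate the
  variances of the means are summable.
\<close>

lemma AE_sample_mean_matrix_tendsto:
  fixes \<pi> :: "(real^'n^'n) measure"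
  assumes W: "prob_space W" and iid: "iid_samples W \<pi> M" and var: "finite_entrywise_variance \<pi>"
    and \<epsilon>s: "\<epsilon>s > 0"
  shows "AE \<omega> in W. \<forall>i j. (\<lambda>t. sample_mean (sample_size \<pi> \<epsilon>s) (\<lambda>k. M k \<omega>) t $ i $ j)
    \<longlonglongrightarrow> expected_matrix \<pi> $ i $ j"
proof -
  interpret prob_space W by (rule W)
  have meas: "M k \<in> borel_measurable W" and distr: "distr W borel (M k) = \<pi>" if "k \<ge> 1" for k
    using iid that unfolding iid_samples_def by auto
  have ind: "indep_vars (\<lambda>_. borel) M {1..}"
    using iid unfolding iid_samples_def by blast
  have "AE \<omega> in W. (\<lambda>t. sample_mean (sample_size \<pi> \<epsilon>s) (\<lambda>k. M k \<omega> $ i $ j) t)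
    \<longlonglongrightarrow> expected_matrix \<pi> $ i $ j" for i j
  proof -
    define \<mu> where "\<mu> = expected_matrix \<pi> $ i $ j"
    define v where "v = (\<integral>A. (A $ i $ j - \<mu>)\<^sup>2 \<partial>\<pi>)"
    have entry [measurable]: "(\<lambda>A. A $ i $ j) \<in> borel_measurable (borel :: (real^'n^'n) measure)"
      by (intro borel_measurable_continuous_onI continuous_intros)
    have int: "integrable \<pi> (\<lambda>A. A $ i $ j)" "integrable \<pi> (\<lambda>A. (A $ i $ j - \<mu>)\<^sup>2)"
      using var unfolding finite_entrywise_variance_def \<mu>_def by auto
    have tr: "integrable W (\<lambda>\<omega>. M k \<omega> $ i $ j)" "integrable W (\<lambda>\<omega>. (M k \<omega> $ i $ j - \<mu>)\<^sup>2)"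
      "(\<integral>\<omega>. M k \<omega> $ i $ j \<partial>W) = \<mu>" "(\<integral>\<omega>. (M k \<omega> $ i $ j - \<mu>)\<^sup>2 \<partial>W) = v" if "k \<ge> 1" for k
    proof -
      show "integrable W (\<lambda>\<omega>. M k \<omega> $ i $ j)"
        by (rule integrable_distr[OF meas[OF that]]) (simp add: distr[OF that] int)
      show "integrable W (\<lambda>\<omega>. (M k \<omega> $ i $ j - \<mu>)\<^sup>2)"
        by (rule integrable_distr[OF meas[OF that]]) (simp add: distr[OF that] int)
      have "(\<integral>A. A $ i $ j \<partial>distr W borel (M k)) = (\<integral>\<omega>. M k \<omega> $ i $ j \<partial>W)"
        by (rule integral_distr[OF meas[OF that]]) simp
      then show "(\<integral>\<omega>. M k \<omega> $ i $ j \<partial>W) = \<mu>"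
        by (simp add: distr[OF that] \<mu>_def expected_matrix_def)
      have "(\<integral>A. (A $ i $ j - \<mu>)\<^sup>2 \<partial>distr W borel (M k)) = (\<integral>\<omega>. (M k \<omega> $ i $ j - \<mu>)\<^sup>2 \<partial>W)"
        by (rule integral_distr[OF meas[OF that]]) simp
      then show "(\<integral>\<omega>. (M k \<omega> $ i $ j - \<mu>)\<^sup>2 \<partial>W) = v"
        by (simp add: distr[OF that] v_def)
    qed
    have ind': "indep_vars (\<lambda>_. borel) (\<lambda>k \<omega>. M k \<omega> $ i $ j) {1..}"
      by (rule indep_vars_compose2[where Y="\<lambda>_ A. A $ i $ j", OF ind]) simp
    have size: "real t powr (1 + \<epsilon>s) \<le> real (sample_size \<pi> \<epsilon>s t)" if "t \<ge> 1" for t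
    proof -
      have "real t powr (1 + \<epsilon>s) \<le> real t powr (2 + \<epsilon>s)" using that by (intro powr_mono) auto
      moreover have "x \<le> real (nat \<lceil>x\<rceil>)" for x by (rule real_nat_ceiling_ge)
      ultimately show ?thesis unfolding sample_size_def by (auto intro: order_trans)
    qed
    show ?thesis
      unfolding \<mu>_def[symmetric]
      by (rule AE_sample_mean_tendsto[OF W ind' tr _ size]) (use \<epsilon>s in auto)
  qed
  then have "AE \<omega> in W. \<forall>i\<in>UNIV. \<forall>j\<in>UNIV.
      (\<lambda>t. sample_mean (sample_size \<pi> \<epsilon>s) (\<lambda>k. M k \<omega> $ i $ j) t) \<longlonglongrightarrow> expected_matrix \<pi> $ i $ j"
    by (intro AE_finite_allI finite)
  then show ?thesis by (simp add: sample_mean_def)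
qed

section \<open>Gradients and the Lipschitz constants\<close>

lemma gradientI:
  assumes "GDERIV f x :> g"
  shows "gradient f x = g"
  unfolding gradient_def
proof (rule the_equality)
  fix g' assume "GDERIV f x :> g'"
  then have "(\<lambda>h. h \<bullet> g') = (\<lambda>h. h \<bullet> g)"
    using assms unfolding gderiv_def by (rule has_derivative_unique)
  then have "\<forall>h. h \<bullet> g' = h \<bullet> g" by (rule fun_cong[THEN allI])
  then show "g' = g" by (simp only: vector_eq_ldot)
qed (rule assms)

lemma GDERIV_gradient:
  fixes f :: "'a::euclidean_space \<Rightarrow> real"
  assumes "f differentiable at x"
  shows "GDERIV f x :> gradient f x"
proof -
  obtain D where D: "(f has_derivative D) (at x)"
    using assms unfolding differentiable_def by blast
  then interpret D: bounded_linear D by (rule has_derivative_bounded_linear)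
  have "D h = h \<bullet> (\<Sum>b\<in>Basis. D b *\<^sub>R b)" for h
  proof -
    have "D h = D (\<Sum>b\<in>Basis. (h \<bullet> b) *\<^sub>R b)" by (simp add: euclidean_representation)
    also have "\<dots> = (\<Sum>b\<in>Basis. (h \<bullet> b) * D b)" by (simp add: D.sum D.scaleR)
    finally show ?thesis by (simp add: inner_sum_right mult.commute)
  qed
  then have "D = (\<lambda>h. h \<bullet> (\<Sum>b\<in>Basis. D b *\<^sub>R b))" by (rule ext)
  with D have "GDERIV f x :> (\<Sum>b\<in>Basis. D b *\<^sub>R b)" unfolding gderiv_def by simp
  then show ?thesis using gradientI by metis
qed

text \<open>
  The Lagrange remainder along a segment involves only the quadratic form of the second derivative,
  which is what bounds in the Loewner order control.
\<close>

lemma second_order_taylor: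
  fixes f :: "'a::real_inner \<Rightarrow> real"
  assumes f: "\<And>u. GDERIV f u :> G u"
    and G: "\<And>u. (G has_derivative H u) (at u)"
  shows "\<exists>\<xi>. f (x + d) - f x - G x \<bullet> d = (d \<bullet> H \<xi> d) / 2"
proof -
  define D where "D m t = (if m = 0 then f (x + t *\<^sub>R d)
      else if m = 1 then G (x + t *\<^sub>R d) \<bullet> d else H (x + t *\<^sub>R d) d \<bullet> d)" for m :: nat and t :: real
  have line: "((\<lambda>t. x + t *\<^sub>R d) has_derivative (\<lambda>s. s *\<^sub>R d)) (at t)" for t :: real
    by (auto intro!: derivative_eq_intros)
  have lin: "linear (H u)" for u
    using G has_derivative_linear by blast
  have D0: "DERIV (\<lambda>t. f (x + t *\<^sub>R d)) t :> G (x + t *\<^sub>R d) \<bullet> d" for t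
  proof -
    have "((\<lambda>t. f (x + t *\<^sub>R d)) has_derivative (\<lambda>s. (s *\<^sub>R d) \<bullet> G (x + t *\<^sub>R d))) (at t)"
      using has_derivative_compose[OF line f[unfolded gderiv_def]] .
    then show ?thesis
      by (rule has_derivative_imp_has_field_derivative) (simp add: inner_commute mult.commute)
  qed
  have D1: "DERIV (\<lambda>t. G (x + t *\<^sub>R d) \<bullet> d) t :> H (x + t *\<^sub>R d) d \<bullet> d" for t
  proof -
    have "((\<lambda>t. G (x + t *\<^sub>R d) \<bullet> d) has_derivative (\<lambda>s. H (x + t *\<^sub>R d) (s *\<^sub>R d) \<bullet> d)) (at t)"
      by (rule has_derivative_inner_left[OF has_derivative_compose[OF line G]])
    then show ?thesis
      by (rule has_derivative_imp_has_field_derivative) (simp add: linear_scale[OF lin] mult.commute)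
  qed
  have "\<forall>m t. m < 2 \<and> 0 \<le> t \<and> t \<le> 1 \<longrightarrow> DERIV (D m) t :> D (Suc m) t"
    using D0 D1 by (auto simp: D_def[abs_def] less_2_cases_iff)
  from Maclaurin[of 1 2 D "D 0", OF _ _ refl this]
  obtain t where "D 0 1 = (\<Sum>m<2. D m 0 / fact m * 1 ^ m) + D 2 t / fact 2 * 1 ^ 2"
    by auto
  then have "f (x + d) - f x - G x \<bullet> d = (d \<bullet> H (x + t *\<^sub>R d) d) / 2"
    by (simp add: D_def numeral_2_eq_2 inner_commute)
  then show ?thesis by blast
qed

text \<open>
  The Baillon--Haddad argument. For fixed \<open>u\<close> the Bregman distance to \<open>u\<close> is a nonnegative function
  of \<open>v\<close> with gradient \<open>G v - G u\<close>; a gradient step of length \<open>1/L\<close> lowers it by at least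
  \<open>|G v - G u|\<^sup>2 / (2 L)\<close>, so it was at least that large. Adding this bound for \<open>(u, v)\<close> and
  \<open>(v, u)\<close> gives cocoercivity of \<open>G\<close>, and Cauchy--Schwarz gives the Lipschitz bound. For a twice
  differentiable \<open>f\<close> with Hessian between 0 and \<open>L I\<close>, the hypotheses are Taylor's theorem.
\<close>

lemma lipschitz_gradient_of_bregman_bounds:
  fixes f :: "'a::real_inner \<Rightarrow> real"
  assumes L: "L > 0"
    and lower: "\<And>u v. 0 \<le> f v - f u - G u \<bullet> (v - u)"
    and upper: "\<And>u v. f v - f u - G u \<bullet> (v - u) \<le> L / 2 * (norm (v - u))\<^sup>2"
  shows "norm (G v - G u) \<le> L * norm (v - u)"
proof -
  have gap: "(norm (G v - G u))\<^sup>2 / (2 * L) \<le> f v - f u - G u \<bullet> (v - u)" for u v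
  proof -
    define e where "e = G v - G u"
    define w where "w = v - (1 / L) *\<^sub>R e"
    have "f w - f v - G v \<bullet> (w - v) \<le> L / 2 * (norm (w - v))\<^sup>2" by (rule upper)
    also have "w - v = - (1 / L) *\<^sub>R e" by (simp add: w_def)
    also have "L / 2 * (norm (- (1 / L) *\<^sub>R e))\<^sup>2 = (norm e)\<^sup>2 / (2 * L)"
      using L by (simp add: power_divide power2_eq_square)
    finally have "f w \<le> f v - (G v \<bullet> e) / L + (norm e)\<^sup>2 / (2 * L)" by simp
    moreover have "0 \<le> f w - f u - G u \<bullet> (w - u)" by (rule lower)
    moreover have "G u \<bullet> (w - u) = G u \<bullet> (v - u) - (G u \<bullet> e) / L"
      by (simp add: w_def inner_diff_right)
    moreover have "(G v \<bullet> e) / L - (G u \<bullet> e) / L = (norm e)\<^sup>2 / L"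
      by (simp add: e_def power2_norm_eq_inner inner_diff_left diff_divide_distrib)
    moreover have "(norm e)\<^sup>2 / L = 2 * ((norm e)\<^sup>2 / (2 * L))" by simp
    ultimately show ?thesis unfolding e_def by linarith
  qed
  have "(norm (G v - G u))\<^sup>2 / L \<le> (G v - G u) \<bullet> (v - u)"
    using gap[where v=v and u=u] gap[where v=u and u=v]
    by (simp add: norm_minus_commute inner_diff_left inner_diff_right)
  also have "\<dots> \<le> norm (G v - G u) * norm (v - u)" by (rule norm_cauchy_schwarz)
  finally show ?thesis
    using L by (cases "G v = G u") (auto simp: power2_eq_square field_simps)
qed

lemma empirical_lipschitz_bounds:
  assumes "L \<ge> 0" and "\<And>u v. norm (F v - F u) \<le> L * norm (v - u)"
  shows "0 \<le> empirical_lipschitz F x" "empirical_lipschitz F x \<le> ereal L"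
proof -
  have le: "ereal (norm (F (x (Suc t)) - F (x t)) / norm (x (Suc t) - x t)) \<le> ereal L"
    if "x (Suc t) \<noteq> x t" for t
    using assms(2)[of "x (Suc t)" "x t"] that by (simp add: divide_le_eq)
  show "0 \<le> empirical_lipschitz F x"
    unfolding empirical_lipschitz_def
    by (auto intro!: SUP_upper2)
  show "empirical_lipschitz F x \<le> ereal L"
    using assms(1) le unfolding empirical_lipschitz_def by (auto intro!: SUP_least)
qed

lemma ereal_square_le:
  assumes "0 \<le> a" "a \<le> ereal L"
  shows "a\<^sup>2 \<le> ereal (L\<^sup>2)"
proof -
  obtain r where "a = ereal r" "0 \<le> r" "r \<le> L"
    using assms by (cases a) auto
  then show ?thesis by (simp add: power_mono)
qed

context
  fixes h \<phi> :: "real^'n \<Rightarrow> real" and \<gamma> :: real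
  assumes h: "twice_continuously_differentiable h"
    and \<gamma>: "\<gamma> > 0"
    and bounded_hessian:
      "\<And>u. loewner_le (- \<gamma> *\<^sub>R mat 1) (hessian h u) \<and> loewner_le (hessian h u) (\<gamma> *\<^sub>R mat 1)"
    and \<phi>: "\<phi> = (\<lambda>u. \<gamma> / 2 * (norm u)\<^sup>2 - h u)"
begin

lemma gradient_\<phi>: "gradient \<phi> u = \<gamma> *\<^sub>R u - gradient h u"
proof (rule gradientI)
  have "GDERIV h u :> gradient h u"
    using h GDERIV_gradient unfolding twice_continuously_differentiable_def by blast
  then have h': "(h has_derivative (\<lambda>v. v \<bullet> gradient h u)) (at u)"
    unfolding gderiv_def .
  show "GDERIV \<phi> u :> \<gamma> *\<^sub>R u - gradient h u"
    unfolding \<phi> gderiv_def power2_norm_eq_inner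
    by (rule derivative_eq_intros h' refl)+
       (auto simp: inner_diff_right inner_commute algebra_simps)
qed

text \<open>
  The Bregman distance of \<open>\<phi>\<close> is \<open>\<gamma>/2 |v - u|\<^sup>2\<close> minus the first-order Taylor remainder of \<open>h\<close>,
  whose modulus is at most \<open>\<gamma>/2 |v - u|\<^sup>2\<close> by the Hessian bound.
\<close>

lemma bregman_\<phi>_bounds:
  "0 \<le> \<phi> v - \<phi> u - gradient \<phi> u \<bullet> (v - u)"
  "\<phi> v - \<phi> u - gradient \<phi> u \<bullet> (v - u) \<le> 2 * \<gamma> / 2 * (norm (v - u))\<^sup>2"
proof -
  have G: "GDERIV h w :> gradient h w" for w
    using h GDERIV_gradient unfolding twice_continuously_differentiable_def by blast
  have H: "(gradient h has_derivative (\<lambda>v. hessian h w *v v)) (at w)" for w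
    using h jacobian_works unfolding twice_continuously_differentiable_def hessian_def by blast
  obtain \<xi> where \<xi>: "h (u + (v - u)) - h u - gradient h u \<bullet> (v - u) =
      ((v - u) \<bullet> (hessian h \<xi> *v (v - u))) / 2"
    using second_order_taylor[OF G H] by blast
  have quad: "\<bar>(v - u) \<bullet> (hessian h \<xi> *v (v - u))\<bar> \<le> \<gamma> * (norm (v - u))\<^sup>2"
  proof -
    have "0 \<le> (v - u) \<bullet> ((hessian h \<xi> - (- \<gamma>) *\<^sub>R mat 1) *v (v - u))"
      "0 \<le> (v - u) \<bullet> ((\<gamma> *\<^sub>R mat 1 - hessian h \<xi>) *v (v - u))"
      using bounded_hessian[of \<xi>] unfolding loewner_le_def by blast+
    then show ?thesis
      unfolding matrix_vector_mult_diff_rdistrib inner_diff_right scaleR_matrix_vector_assoc[symmetric]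
        matrix_vector_mul_lid inner_scaleR_right power2_norm_eq_inner
      by (simp add: abs_le_iff inner_diff_right algebra_simps)
  qed
  have "\<phi> v - \<phi> u - gradient \<phi> u \<bullet> (v - u) =
      \<gamma> / 2 * (norm (v - u))\<^sup>2 - (h v - h u - gradient h u \<bullet> (v - u))"
    unfolding gradient_\<phi> unfolding \<phi> power2_norm_eq_inner
    by (simp add: inner_diff_left inner_diff_right inner_commute field_simps)
  then show "0 \<le> \<phi> v - \<phi> u - gradient \<phi> u \<bullet> (v - u)"
    "\<phi> v - \<phi> u - gradient \<phi> u \<bullet> (v - u) \<le> 2 * \<gamma> / 2 * (norm (v - u))\<^sup>2"
    using \<xi> quad by (auto simp: abs_le_iff)
qed

text \<open>\<open>5 \<gamma>\<^sup>2\<close> arises as \<open>\<gamma>\<^sup>2 + (2 \<gamma>)\<^sup>2\<close>.\<close>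

lemma empirical_lipschitz_\<phi>:
  "(empirical_lipschitz (\<lambda>u. gradient h u + gradient \<phi> u) x)\<^sup>2 +
   (empirical_lipschitz (gradient \<phi>) x)\<^sup>2 \<le> ereal (5 * \<gamma>\<^sup>2)"
proof -
  have "norm (gradient \<phi> v - gradient \<phi> u) \<le> 2 * \<gamma> * norm (v - u)" for u v
    by (rule lipschitz_gradient_of_bregman_bounds[of _ \<phi>, OF _ bregman_\<phi>_bounds]) (simp add: \<gamma>)
  then have 1: "(empirical_lipschitz (gradient \<phi>) x)\<^sup>2 \<le> ereal ((2 * \<gamma>)\<^sup>2)"
    using \<gamma> by (intro ereal_square_le empirical_lipschitz_bounds[where L="2 * \<gamma>"]) auto
  have "norm ((gradient h v + gradient \<phi> v) - (gradient h u + gradient \<phi> u)) \<le> \<gamma> * norm (v - u)" for u v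
    using \<gamma> by (simp add: gradient_\<phi> flip: scaleR_diff_right)
  then have 2: "(empirical_lipschitz (\<lambda>u. gradient h u + gradient \<phi> u) x)\<^sup>2 \<le> ereal (\<gamma>\<^sup>2)"
    using \<gamma> by (intro ereal_square_le empirical_lipschitz_bounds[where L=\<gamma>]) auto
  show ?thesis
    using add_mono[OF 2 1] by (simp add: power2_eq_square)
qed

end

section \<open>Descent of the subproblem\<close>

lemma critical_point_of_quadratic:
  fixes f :: "'a::real_inner \<Rightarrow> real"
  assumes crit: "GDERIV f u :> 0"
    and quad: "\<And>t. f (u + t *\<^sub>R d) = f u + c * t + q * t\<^sup>2"
  shows "f (u + d) = f u + q"
proof -
  have "((\<lambda>t. u + t *\<^sub>R d) has_derivative (\<lambda>s. s *\<^sub>R d)) (at 0)"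
    by (auto intro!: derivative_eq_intros)
  moreover have "(f has_derivative (\<lambda>v. v \<bullet> 0)) (at (u + 0 *\<^sub>R d))"
    using crit by (simp add: gderiv_def)
  ultimately have "((\<lambda>t. f (u + t *\<^sub>R d)) has_derivative (\<lambda>s. (s *\<^sub>R d) \<bullet> 0)) (at 0)"
    by (rule has_derivative_compose)
  then have "DERIV (\<lambda>t. f (u + t *\<^sub>R d)) 0 :> 0"
    by (rule has_derivative_imp_has_field_derivative) simp
  moreover have "DERIV (\<lambda>t. f u + c * t + q * t\<^sup>2) 0 :> c"
    by (auto intro!: derivative_eq_intros)
  ultimately have "c = 0"
    unfolding quad using DERIV_unique by blast
  with quad[of 1] show ?thesis by simp
qed

text \<open>
  The terms in \<open>h\<close> cancel against the Bregman distance, and along every line through \<open>u\<close> the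
  objective is a quadratic polynomial with the leading coefficient \<open>q\<close> below. The decrease to a
  critical point is then exactly \<open>q\<close>.
\<close>

lemma g_objective_descent:
  fixes h :: "real^'n \<Rightarrow> real"
  assumes \<phi>: "\<phi> = (\<lambda>u. \<gamma> / 2 * (norm u)\<^sup>2 - h u)"
    and crit: "GDERIV (g_objective h \<phi> b A z y xt) u :> 0" and b: "b \<ge> 0"
  shows "g_objective h \<phi> b A z y xt u - g_objective h \<phi> b A z y xt v \<le>
    - ((\<gamma> + b * lambda_min (transpose A ** A)) / 2) * (norm (u - v))\<^sup>2"
proof -
  let ?g = "g_objective h \<phi> b A z y xt"
  define d where "d = v - u"
  define q where "q = (\<gamma> * (norm d)\<^sup>2 + b * (norm (A *v d))\<^sup>2) / 2"
  define c where "c = \<gamma> * (u \<bullet> d) + b * ((A *v u - y) \<bullet> (A *v d)) - z \<bullet> (A *v d) - gradient \<phi> xt \<bullet> d"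
  have "?g (u + t *\<^sub>R d) = ?g u + c * t + q * t\<^sup>2" for t
    unfolding g_objective_def bregman_def c_def q_def
    unfolding \<phi>
    unfolding power2_norm_eq_inner
    by (simp add: matrix_vector_right_distrib matrix_vector_mult_scaleR inner_add_left inner_add_right
        inner_diff_left inner_diff_right inner_commute power2_eq_square field_simps)
  then have "?g (u + d) = ?g u + q"
    by (rule critical_point_of_quadratic[OF crit])
  then have "?g u - ?g v = - q" by (simp add: d_def)
  moreover have "b * (lambda_min (transpose A ** A) * (norm d)\<^sup>2) \<le> b * (norm (A *v d))\<^sup>2"
    using b by (intro mult_left_mono lambda_min_gram_le)
  ultimately show ?thesis
    by (simp add: q_def d_def norm_minus_commute field_simps)
qed

section \<open>Stabilisation of the penalties\<close>

text \<open>
  The reset value of the oracle, multiplied by the eigenvalue, is the positive root of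
  \<open>u\<^sup>2 + \<gamma> u = (1 + \<epsilon>) 40 \<gamma>\<^sup>2\<close>.
\<close>

lemma APO_B_reset:
  fixes \<gamma> \<epsilon> :: real
  assumes "\<gamma> > 0" "\<epsilon> > 0"
  defines "u \<equiv> (- \<gamma> + sqrt (\<gamma>\<^sup>2 + (1 + \<epsilon>) * 160 * \<gamma>\<^sup>2)) / 2"
  shows "u > 0" "u * (u + \<gamma>) = (1 + \<epsilon>) * (40 * \<gamma>\<^sup>2)"
proof -
  define r where "r = sqrt (\<gamma>\<^sup>2 + (1 + \<epsilon>) * 160 * \<gamma>\<^sup>2)"
  have r2: "r\<^sup>2 = \<gamma>\<^sup>2 + (1 + \<epsilon>) * 160 * \<gamma>\<^sup>2"
    unfolding r_def using assms by (intro real_sqrt_pow2) simp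
  have "sqrt (\<gamma>\<^sup>2) < r"
    unfolding r_def using assms by (intro real_sqrt_less_mono) simp
  then show "u > 0" using assms by (simp add: u_def r_def)
  have "u * (u + \<gamma>) = (r\<^sup>2 - \<gamma>\<^sup>2) / 4"
    unfolding u_def r_def[symmetric] by (simp add: field_simps power2_eq_square)
  then show "u * (u + \<gamma>) = (1 + \<epsilon>) * (40 * \<gamma>\<^sup>2)" by (simp add: r2 algebra_simps)
qed

lemma APO_B_pos:
  assumes "\<gamma> > 0" "\<epsilon> > 0" "b > 0"
  shows "APO_B \<gamma> \<epsilon> b A > 0"
  using APO_B_reset(1)[OF assms(1,2)] lambda_min_gram_nonneg[of A] assms(3)
  unfolding APO_B_def Let_def by (auto simp: field_simps intro!: divide_pos_pos)

text \<open>Clearing denominators turns the test of the oracle into a window for \<open>u (u + \<gamma>)\<close>.\<close>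

lemma APO_B_cases:
  assumes "b > 0" "lambda_min (transpose A ** A) > 0"
  defines "u \<equiv> lambda_min (transpose A ** A) * b"
  shows "APO_B \<gamma> \<epsilon> b A =
    (if (1 + \<epsilon> / 2) * (40 * \<gamma>\<^sup>2) < u * (u + \<gamma>) \<and> u * (u + \<gamma>) < (1 + 2 * \<epsilon>) * (40 * \<gamma>\<^sup>2) then b
     else (- \<gamma> + sqrt (\<gamma>\<^sup>2 + (1 + \<epsilon>) * 160 * \<gamma>\<^sup>2)) / 2 / lambda_min (transpose A ** A))"
proof -
  have "u > 0" using assms by simp
  then show ?thesis
    using assms(2) unfolding APO_B_def Let_def u_def[symmetric]
    by (simp add: pos_divide_less_eq pos_less_divide_eq mult.commute)
qed

text \<open>
  A reset at step \<open>j\<close> sets the penalty to \<open>u / s j\<close>, and the test at a later step \<open>i\<close> sees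
  \<open>s i (u / s j)\<close>, which tends to \<open>u\<close> as \<open>i\<close> and \<open>j\<close> grow independently. Hence from some \<open>N\<close> on no
  test fails after a reset: either there is no reset after \<open>N\<close>, or the first one is the last.
\<close>

lemma penalties_stabilise:
  fixes A :: "nat \<Rightarrow> real^'n^'n" and b :: "nat \<Rightarrow> real"
  defines "s \<equiv> \<lambda>t. lambda_min (transpose (A t) ** A t)"
  assumes lim: "s \<longlonglongrightarrow> \<sigma>" and \<sigma>: "\<sigma> > 0" and \<gamma>: "\<gamma> > 0" and \<epsilon>: "\<epsilon> > 0"
    and pos: "\<And>t. b t > 0" and step: "\<And>t. b (Suc t) = APO_B \<gamma> \<epsilon> (b t) (A (Suc t))"
  shows "\<exists>K. \<forall>k\<ge>K. b k = b K \<and>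
    (1 + \<epsilon> / 2) * (40 * \<gamma>\<^sup>2) < s (Suc k) * b K * (s (Suc k) * b K + \<gamma>)"
proof -
  define window where "window v \<longleftrightarrow>
    (1 + \<epsilon> / 2) * (40 * \<gamma>\<^sup>2) < v * (v + \<gamma>) \<and> v * (v + \<gamma>) < (1 + 2 * \<epsilon>) * (40 * \<gamma>\<^sup>2)" for v
  define u where "u = (- \<gamma> + sqrt (\<gamma>\<^sup>2 + (1 + \<epsilon>) * 160 * \<gamma>\<^sup>2)) / 2"
  note u = APO_B_reset[OF \<gamma> \<epsilon>, folded u_def]
  have "filterlim fst sequentially (sequentially \<times>\<^sub>F sequentially)"
    "filterlim snd sequentially (sequentially \<times>\<^sub>F sequentially)"
    by (rule filterlim_fst filterlim_snd)+
  then have "((\<lambda>p. s (fst p)) \<longlongrightarrow> \<sigma>) (sequentially \<times>\<^sub>F sequentially)"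
    "((\<lambda>p. s (snd p)) \<longlongrightarrow> \<sigma>) (sequentially \<times>\<^sub>F sequentially)"
    by (auto intro: filterlim_compose[OF lim])
  then have "((\<lambda>p. (s (fst p) * (u / s (snd p))) * (s (fst p) * (u / s (snd p)) + \<gamma>)) \<longlongrightarrow>
      (\<sigma> * (u / \<sigma>)) * (\<sigma> * (u / \<sigma>) + \<gamma>)) (sequentially \<times>\<^sub>F sequentially)"
    using \<sigma> by (intro tendsto_intros) auto
  then have lim2: "((\<lambda>p. (s (fst p) * (u / s (snd p))) * (s (fst p) * (u / s (snd p)) + \<gamma>)) \<longlongrightarrow>
      (1 + \<epsilon>) * (40 * \<gamma>\<^sup>2)) (sequentially \<times>\<^sub>F sequentially)"
    using \<sigma> u by simp
  have "(1 + \<epsilon> / 2) * (40 * \<gamma>\<^sup>2) < (1 + \<epsilon>) * (40 * \<gamma>\<^sup>2)" "(1 + \<epsilon>) * (40 * \<gamma>\<^sup>2) < (1 + 2 * \<epsilon>) * (40 * \<gamma>\<^sup>2)"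
    using \<gamma> \<epsilon> by (auto intro!: mult_strict_right_mono)
  then have "\<forall>\<^sub>F p in sequentially \<times>\<^sub>F sequentially. window (s (fst p) * (u / s (snd p)))"
    unfolding window_def using order_tendstoD[OF lim2] by (intro eventually_conj) auto
  then obtain N1 where N1: "\<And>i j. i \<ge> N1 \<Longrightarrow> j \<ge> N1 \<Longrightarrow> window (s i * (u / s j))"
    unfolding eventually_prod_sequentially by auto
  obtain N2 where N2: "\<And>i. i \<ge> N2 \<Longrightarrow> s i > 0"
    using order_tendstoD(1)[OF lim \<sigma>] unfolding eventually_sequentially by auto
  define N where "N = max N1 N2"
  have step': "b (Suc k) = (if window (s (Suc k) * b k) then b k else u / s (Suc k))" if "k \<ge> N" for k
  proof -
    have "s (Suc k) > 0" using that by (intro N2) (simp add: N_def)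
    then show ?thesis
      using step[of k] APO_B_cases[OF pos[of k], of "A (Suc k)" \<gamma> \<epsilon>]
      by (simp add: window_def u_def s_def)
  qed
  have stable: "b k = b K \<and> window (s (Suc k) * b K)"
    if "K \<ge> N" "k \<ge> K" and w: "\<And>k. k \<ge> K \<Longrightarrow> b k = b K \<Longrightarrow> window (s (Suc k) * b K)" for k K
    using \<open>k \<ge> K\<close>
  proof (induction k rule: dec_induct)
    case (step k)
    then have "b (Suc k) = b K" using step'[of k] \<open>K \<ge> N\<close> by simp
    then show ?case using w[of "Suc k"] step by simp
  qed (use w in simp)
  have "\<exists>K. \<forall>k\<ge>K. b k = b K \<and> window (s (Suc k) * b K)"
  proof (cases "\<forall>k\<ge>N. window (s (Suc k) * b k)")
    case True
    then show ?thesis using stable[of N] by (metis order_refl)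
  next
    case False
    then obtain k where k: "k \<ge> N" "\<not> window (s (Suc k) * b k)" by blast
    then have "b (Suc k) = u / s (Suc k)" using step' by simp
    then have "window (s (Suc j) * b (Suc k))" if "j \<ge> Suc k" for j
      using N1[of "Suc j" "Suc k"] that k(1) by (simp add: N_def)
    then show ?thesis using stable[of "Suc k"] k(1) by (metis le_Suc_eq)
  qed
  then show ?thesis unfolding window_def by blast
qed

text \<open>
  The test at step \<open>k\<close> bounds the penalty against \<open>s (Suc k)\<close>, whereas \<open>\<rho>\<close> has to be compared with
  \<open>\<sigma>\<close>. The slack \<open>\<epsilon>/2\<close> in the test absorbs the difference in the limit.
\<close>

lemma stabilised_penalty_margin:
  fixes s :: "nat \<Rightarrow> real"
  assumes lim: "s \<longlonglongrightarrow> \<sigma>" and \<sigma>: "\<sigma> > 0" and \<gamma>: "\<gamma> > 0" and \<epsilon>: "\<epsilon> > 0" and b: "b > 0"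
    and test: "\<And>k. k \<ge> K \<Longrightarrow> (1 + \<epsilon> / 2) * (40 * \<gamma>\<^sup>2) < s (Suc k) * b * (s (Suc k) * b + \<gamma>)"
  shows "\<exists>\<rho> K'. 40 * \<gamma>\<^sup>2 / (b * \<sigma>) < \<rho> \<and> (\<forall>k\<ge>K'. \<rho> \<le> \<gamma> + b * s (Suc k))"
proof -
  have lim': "(\<lambda>k. s (Suc k)) \<longlonglongrightarrow> \<sigma>" using lim by (rule LIMSEQ_Suc)
  then have "(\<lambda>k. s (Suc k) * b * (s (Suc k) * b + \<gamma>)) \<longlonglongrightarrow> \<sigma> * b * (\<sigma> * b + \<gamma>)"
    by (intro tendsto_intros)
  then have "(1 + \<epsilon> / 2) * (40 * \<gamma>\<^sup>2) \<le> \<sigma> * b * (\<sigma> * b + \<gamma>)"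
    by (rule LIMSEQ_le_const) (use test in \<open>auto intro: less_imp_le\<close>)
  moreover have "40 * \<gamma>\<^sup>2 < (1 + \<epsilon> / 2) * (40 * \<gamma>\<^sup>2)"
    using \<gamma> \<epsilon> by simp
  ultimately have "40 * \<gamma>\<^sup>2 / (b * \<sigma>) < \<gamma> + b * \<sigma>"
    using b \<sigma> by (simp add: pos_divide_less_eq algebra_simps)
  then obtain \<rho> where \<rho>: "40 * \<gamma>\<^sup>2 / (b * \<sigma>) < \<rho>" "\<rho> < \<gamma> + b * \<sigma>"
    using dense by blast
  have "(\<lambda>k. \<gamma> + b * s (Suc k)) \<longlonglongrightarrow> \<gamma> + b * \<sigma>"
    using lim' by (intro tendsto_intros)
  from order_tendstoD(1)[OF this \<rho>(2)] show ?thesis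
    using \<rho>(1) unfolding eventually_sequentially by (meson less_imp_le)
qed

section \<open>The requirements on the penalty oracle\<close>

theorem theorem2:
  fixes h \<phi> :: "real^'n \<Rightarrow> real"
    and P :: "real^'n \<Rightarrow> ereal"
    and W :: "'w measure"
    and \<pi> :: "(real^'n^'n) measure"
    and M Mbar :: "nat \<Rightarrow> 'w \<Rightarrow> real^'n^'n"
    and x y z :: "nat \<Rightarrow> 'w \<Rightarrow> real^'n"
    and \<beta> :: "nat \<Rightarrow> 'w \<Rightarrow> real"
    and x0 z0 :: "real^'n"
    and \<beta>0 \<gamma> \<epsilon> \<epsilon>s \<sigma> :: real
  assumes "twice_continuously_differentiable h"
    and "proper_fun P" and "lower_semicontinuous P" and "prox_tractable P"
    and "prob_space W" and "iid_samples W \<pi> M"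
    and "finite_entrywise_variance \<pi>"
    and "rank (expected_matrix \<pi>) = CARD('n)"
    and "\<sigma> = lambda_min (transpose (expected_matrix \<pi>) ** expected_matrix \<pi>)"
    and "\<epsilon>s > 0"
    and "Mbar = (\<lambda>t \<omega>. sample_mean (sample_size \<pi> \<epsilon>s) (\<lambda>i. M i \<omega>) t)"
    and "\<gamma> > 0" and "\<epsilon> > 0" and "\<beta>0 > 0"
    and "\<And>u. loewner_le (- \<gamma> *\<^sub>R mat 1) (hessian h u) \<and> loewner_le (hessian h u) (\<gamma> *\<^sub>R mat 1)"
    and "\<phi> = (\<lambda>u. \<gamma> / 2 * (norm u)\<^sup>2 - h u)"
    and "\<And>\<omega>. \<omega> \<in> space W \<Longrightarrow>
           meta_ISAD_run h P \<phi> (APO_B \<gamma> \<epsilon>) (\<lambda>t. Mbar t \<omega>) x0 z0 \<beta>0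
             (\<lambda>t. x t \<omega>) (\<lambda>t. y t \<omega>) (\<lambda>t. z t \<omega>) (\<lambda>t. \<beta> t \<omega>)"
    and "AE \<omega> in W. bounded ((\<lambda>t. (x t \<omega>, y t \<omega>, z t \<omega>)) ` {0<..})"
  shows "(\<forall>b>0. \<forall>A :: real^'n^'n. APO_B \<gamma> \<epsilon> b A > 0) \<and>
    (AE \<omega> in W. \<exists>K>0.
       (\<forall>k>K. \<beta> k \<omega> = \<beta> K \<omega>) \<and>
       (\<exists>\<rho>>0. \<forall>k>K.
          (let g = meta_ISAD_g h \<phi> (\<lambda>t. Mbar t \<omega>)
                     (\<lambda>t. x t \<omega>) (\<lambda>t. y t \<omega>) (\<lambda>t. z t \<omega>) (\<lambda>t. \<beta> t \<omega>) (Suc k)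
           in g (x (Suc k) \<omega>) - g (x k \<omega>)
                \<le> - (\<rho> / 2) * (norm (x (Suc k) \<omega> - x k \<omega>))\<^sup>2) \<and>
          ereal \<rho> > ereal (8 / (\<beta> k \<omega> * \<sigma>)) *
            ((empirical_lipschitz (\<lambda>u. gradient h u + gradient \<phi> u) (\<lambda>t. x t \<omega>))\<^sup>2 +
             (empirical_lipschitz (gradient \<phi>) (\<lambda>t. x t \<omega>))\<^sup>2)))"
proof (intro conjI allI impI)
  show "APO_B \<gamma> \<epsilon> b A > 0" if "b > 0" for b and A :: "real^'n^'n"
    using APO_B_pos \<open>\<gamma> > 0\<close> \<open>\<epsilon> > 0\<close> that by blast
next
  have \<sigma>: "\<sigma> > 0" using assms(8,9) lambda_min_gram_pos by blast
  have "AE \<omega> in W. \<forall>i j. (\<lambda>t. Mbar t \<omega> $ i $ j) \<longlonglongrightarrow> expected_matrix \<pi> $ i $ j"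
    using AE_sample_mean_matrix_tendsto[OF assms(5-7) \<open>\<epsilon>s > 0\<close>] by (simp add: assms(11))
  then show "AE \<omega> in W. \<exists>K>0.
       (\<forall>k>K. \<beta> k \<omega> = \<beta> K \<omega>) \<and>
       (\<exists>\<rho>>0. \<forall>k>K.
          (let g = meta_ISAD_g h \<phi> (\<lambda>t. Mbar t \<omega>)
                     (\<lambda>t. x t \<omega>) (\<lambda>t. y t \<omega>) (\<lambda>t. z t \<omega>) (\<lambda>t. \<beta> t \<omega>) (Suc k)
           in g (x (Suc k) \<omega>) - g (x k \<omega>)
                \<le> - (\<rho> / 2) * (norm (x (Suc k) \<omega> - x k \<omega>))\<^sup>2) \<and>
          ereal \<rho> > ereal (8 / (\<beta> k \<omega> * \<sigma>)) *
            ((empirical_lipschitz (\<lambda>u. gradient h u + gradient \<phi> u) (\<lambda>t. x t \<omega>))\<^sup>2 +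
             (empirical_lipschitz (gradient \<phi>) (\<lambda>t. x t \<omega>))\<^sup>2))" (is "AE \<omega> in W. ?good \<omega>")
  proof (rule AE_mp, intro AE_I2 impI)
    fix \<omega>
    assume \<omega>: "\<omega> \<in> space W"
      and conv: "\<forall>i j. (\<lambda>t. Mbar t \<omega> $ i $ j) \<longlonglongrightarrow> expected_matrix \<pi> $ i $ j"
    define s where "s t = lambda_min (transpose (Mbar t \<omega>) ** Mbar t \<omega>)" for t
    have lim: "s \<longlonglongrightarrow> \<sigma>"
      unfolding s_def[abs_def] assms(9) by (rule tendsto_lambda_min_gram) (use conv in blast)
    have run: "meta_ISAD_run h P \<phi> (APO_B \<gamma> \<epsilon>) (\<lambda>t. Mbar t \<omega>) x0 z0 \<beta>0
        (\<lambda>t. x t \<omega>) (\<lambda>t. y t \<omega>) (\<lambda>t. z t \<omega>) (\<lambda>t. \<beta> t \<omega>)"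
      using assms(17) \<omega> by blast
    then have step: "\<beta> (Suc t) \<omega> = APO_B \<gamma> \<epsilon> (\<beta> t \<omega>) (Mbar (Suc t) \<omega>)" for t
      unfolding meta_ISAD_run_def by blast
    have pos: "\<beta> t \<omega> > 0" for t
    proof (induction t)
      case 0
      then show ?case using run \<open>\<beta>0 > 0\<close> by (simp add: meta_ISAD_run_def)
    next
      case (Suc t)
      then show ?case by (simp add: step APO_B_pos \<open>\<gamma> > 0\<close> \<open>\<epsilon> > 0\<close>)
    qed
    obtain K where K: "\<And>k. k \<ge> K \<Longrightarrow> \<beta> k \<omega> = \<beta> K \<omega>"
      and test: "\<And>k. k \<ge> K \<Longrightarrow> (1 + \<epsilon> / 2) * (40 * \<gamma>\<^sup>2) <
        s (Suc k) * \<beta> K \<omega> * (s (Suc k) * \<beta> K \<omega> + \<gamma>)"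
      using penalties_stabilise[of "\<lambda>t. Mbar t \<omega>", folded s_def, OF lim \<sigma> \<open>\<gamma> > 0\<close> \<open>\<epsilon> > 0\<close> pos step]
      by blast
    obtain \<rho> K' where \<rho>: "40 * \<gamma>\<^sup>2 / (\<beta> K \<omega> * \<sigma>) < \<rho>"
      and K': "\<And>k. k \<ge> K' \<Longrightarrow> \<rho> \<le> \<gamma> + \<beta> K \<omega> * s (Suc k)"
      using stabilised_penalty_margin[OF lim \<sigma> \<open>\<gamma> > 0\<close> \<open>\<epsilon> > 0\<close> pos test] by blast
    have "0 < 40 * \<gamma>\<^sup>2 / (\<beta> K \<omega> * \<sigma>)" using pos \<sigma> \<open>\<gamma> > 0\<close> by simp
    then have "\<rho> > 0" using \<rho> by linarith
    \<comment> \<open>The successor makes the index positive.\<close>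
    define N where "N = Suc (max K K')"
    have descent: "meta_ISAD_g h \<phi> (\<lambda>t. Mbar t \<omega>) (\<lambda>t. x t \<omega>) (\<lambda>t. y t \<omega>) (\<lambda>t. z t \<omega>) (\<lambda>t. \<beta> t \<omega>) (Suc k) (x (Suc k) \<omega>)
        - meta_ISAD_g h \<phi> (\<lambda>t. Mbar t \<omega>) (\<lambda>t. x t \<omega>) (\<lambda>t. y t \<omega>) (\<lambda>t. z t \<omega>) (\<lambda>t. \<beta> t \<omega>) (Suc k) (x k \<omega>)
        \<le> - (\<rho> / 2) * (norm (x (Suc k) \<omega> - x k \<omega>))\<^sup>2" (is "?l \<le> _") if "k > N" for k
    proof -
      have crit: "GDERIV (meta_ISAD_g h \<phi> (\<lambda>t. Mbar t \<omega>) (\<lambda>t. x t \<omega>) (\<lambda>t. y t \<omega>) (\<lambda>t. z t \<omega>)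
          (\<lambda>t. \<beta> t \<omega>) (Suc k)) (x (Suc k) \<omega>) :> 0"
        using run unfolding meta_ISAD_run_def by blast
      have "?l \<le> - ((\<gamma> + \<beta> k \<omega> * s (Suc k)) / 2) * (norm (x (Suc k) \<omega> - x k \<omega>))\<^sup>2"
        using g_objective_descent[OF assms(16) crit[unfolded meta_ISAD_g_def diff_Suc_1]] pos[of k]
        unfolding meta_ISAD_g_def diff_Suc_1 s_def by simp
      also have "\<dots> \<le> - (\<rho> / 2) * (norm (x (Suc k) \<omega> - x k \<omega>))\<^sup>2"
        using K'[of k] K[of k] that by (intro mult_right_mono) (auto simp: N_def)
      finally show ?thesis .
    qed
    have large: "ereal (8 / (\<beta> k \<omega> * \<sigma>)) *
            ((empirical_lipschitz (\<lambda>u. gradient h u + gradient \<phi> u) (\<lambda>t. x t \<omega>))\<^sup>2 +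
             (empirical_lipschitz (gradient \<phi>) (\<lambda>t. x t \<omega>))\<^sup>2) < ereal \<rho>" (is "_ * ?L < _") if "k > N" for k
    proof -
      have "ereal (8 / (\<beta> k \<omega> * \<sigma>)) * ?L \<le> ereal (8 / (\<beta> k \<omega> * \<sigma>)) * ereal (5 * \<gamma>\<^sup>2)"
        using pos[of k] \<sigma>
        by (intro ereal_mult_left_mono empirical_lipschitz_\<phi> assms(1,12,15,16)) simp
      also have "\<dots> = ereal (40 * \<gamma>\<^sup>2 / (\<beta> K \<omega> * \<sigma>))"
        using K[of k] that by (simp add: N_def)
      also have "\<dots> < ereal \<rho>" using \<rho> by simp
      finally show ?thesis .
    qed
    have "\<beta> k \<omega> = \<beta> N \<omega>" if "k > N" for k
      using K[of k] K[of N] that by (simp add: N_def)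
    then show "?good \<omega>"
      using descent large \<open>\<rho> > 0\<close> unfolding Let_def by (intro exI[of _ N]) (auto simp: N_def)
  qed
qed

end
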